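(* Let $T \in \mathbb{R}^{n\times n}$ and $A = I - T$. Assume that $T \geq 0$ entrywise, that $\rho(T) < 1$, and that $\mathrm{spec}(A) \subset \mathbb{R}^+$ (all eigenvalues of $A$ are real and positive). Let $\rho = \rho(T)$ and, for $\alpha \in \mathbb{R}$, let $T_\alpha = (1-\alpha) I + \alpha T = I - \alpha A$. Then $\rho(|T_\alpha|) < 1$ for every $\alpha \in \left(0, \tfrac{2}{1+\rho}\right)$, where $\tfrac{2}{1+\rho} > 1$.
   Context: $\rho(\cdot)$ denotes the spectral radius and $\mathrm{spec}(\cdot)$ the set of (complex) eigenvalues of a square matrix. For a real matrix $B$, $|B|$ denotes the matrix obtained by taking the absolute value of each entry of $B$, and $B \geq 0$ means that all entries are non-negative. $T_\alpha$ is the iteration matrix of the first order Richardson method $x^{k+1} = x^k + \alpha(c - A x^k)$ for solving $Ax = c$; the condition $\rho(|T_\alpha|)<1$ is the criterion for convergence of the asynchronous version of this iteration. *)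

theory Defs
  imports "Jordan_Normal_Form.Spectral_Radius"
begin

text \<open>The library's \<^const>\<open>spectral_radius\<close> is defined on complex matrices, so real matrices
  are embedded entrywise; eigenvalues of a real matrix are its complex eigenvalues.\<close>

abbreviation complex_mat :: "real mat \<Rightarrow> complex mat" where
  "complex_mat B \<equiv> map_mat complex_of_real B"

definition spec :: "real mat \<Rightarrow> complex set" where
  "spec B = spectrum (complex_mat B)"

definition spec_rad :: "real mat \<Rightarrow> real" where
  "spec_rad B = spectral_radius (complex_mat B)"

definition abs_mat :: "real mat \<Rightarrow> real mat" where
  "abs_mat B = map_mat abs B"

definition nonneg_mat :: "real mat \<Rightarrow> bool" where
  "nonneg_mat B \<longleftrightarrow> (\<forall>i < dim_row B. \<forall>j < dim_col B. 0 \<le> B $$ (i, j))"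

text \<open>The iteration matrix of \<open>x \<mapsto> x + \<alpha> (c - A x)\<close>.\<close>

definition richardson_mat :: "real mat \<Rightarrow> real \<Rightarrow> real mat" where
  "richardson_mat A \<alpha> = 1\<^sub>m (dim_row A) - \<alpha> \<cdot>\<^sub>m A"

end

theory Submission
  imports Defs
begin

text \<open>Entrywise \<open>\<bar>T\<^sub>\<alpha>\<bar> \<le> \<bar>1 - \<alpha>\<bar> I + \<alpha> T\<close>. The spectral radius is monotone under entrywise
  domination by a nonnegative matrix, so \<open>\<rho>(\<bar>T\<^sub>\<alpha>\<bar>) \<le> \<bar>1 - \<alpha>\<bar> + \<alpha> \<rho>(T)\<close>, which is below \<open>1\<close>
  exactly when \<open>0 < \<alpha> < 2 / (1 + \<rho>)\<close>. Monotonicity is obtained by scaling: if \<open>\<rho>(C) < 1\<close> then the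
  powers of \<open>C\<close> are bounded, hence so are those of every dominated \<open>B\<close>, which forces \<open>\<rho>(B) \<le> 1\<close>.\<close>

lemma spectral_radius_nonneg:
  assumes "A \<in> carrier_mat n n" "0 < n"
  shows "0 \<le> spectral_radius A"
  using spectral_radius_mem_max(1)[OF assms] by auto

lemma spectral_radius_leI:
  assumes "A \<in> carrier_mat n n" "0 < n"
    and "\<And>v \<mu>. v \<in> carrier_vec n \<Longrightarrow> v \<noteq> 0\<^sub>v n \<Longrightarrow> A *\<^sub>v v = \<mu> \<cdot>\<^sub>v v \<Longrightarrow> norm \<mu> \<le> b"
  shows "spectral_radius A \<le> b"
  using spectral_radius_mem_max(1)[OF assms(1,2)] assms(1,3)
  by (auto simp: spectrum_def eigenvalue_def eigenvector_def)

lemma norm_eigenvalue_le_spectral_radius: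
  assumes "A \<in> carrier_mat n n" "0 < n"
    and "v \<in> carrier_vec n" "v \<noteq> 0\<^sub>v n" "A *\<^sub>v v = \<mu> \<cdot>\<^sub>v v"
  shows "norm \<mu> \<le> spectral_radius A"
  by (rule spectral_radius_mem_max(2)[OF assms(1,2)])
     (use assms in \<open>auto simp: spectrum_def eigenvalue_def eigenvector_def intro!: imageI\<close>)

text \<open>For \<open>t\<close> nonzero, an eigenvector of the combination for \<mu> is an
  eigenvector of \<open>A\<close> for \<open>(\<mu> - s) / t\<close>, so
  \<open>norm (\<mu> - s)\<close> is at most \<open>norm t * spectral_radius A\<close>; the triangle
  inequality does the rest.\<close>

lemma spectral_radius_affine_le:
  fixes A :: "complex mat"
  assumes A: "A \<in> carrier_mat n n" and n: "0 < n"
  shows "spectral_radius (s \<cdot>\<^sub>m 1\<^sub>m n + t \<cdot>\<^sub>m A) \<le> norm s + norm t * spectral_radius A"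
proof (rule spectral_radius_leI[OF _ n])
  show "s \<cdot>\<^sub>m 1\<^sub>m n + t \<cdot>\<^sub>m A \<in> carrier_mat n n"
    using A by simp
next
  fix v :: "complex vec" and \<mu>
  assume v: "v \<in> carrier_vec n" "v \<noteq> 0\<^sub>v n"
    and ev: "(s \<cdot>\<^sub>m 1\<^sub>m n + t \<cdot>\<^sub>m A) *\<^sub>v v = \<mu> \<cdot>\<^sub>v v"
  have "(s \<cdot>\<^sub>m 1\<^sub>m n + t \<cdot>\<^sub>m A) *\<^sub>v v = (s \<cdot>\<^sub>m 1\<^sub>m n) *\<^sub>v v + (t \<cdot>\<^sub>m A) *\<^sub>v v"
    using A v by (intro add_mult_distrib_mat_vec[where nr=n and nc=n]) auto
  also have "\<dots> = s \<cdot>\<^sub>v v + t \<cdot>\<^sub>v (A *\<^sub>v v)"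
    using A v by (intro eq_vecI) auto
  finally have "s \<cdot>\<^sub>v v + t \<cdot>\<^sub>v (A *\<^sub>v v) = \<mu> \<cdot>\<^sub>v v"
    using ev by simp
  then have comp: "s * v $ i + t * (A *\<^sub>v v) $ i = \<mu> * v $ i" if "i < n" for i
    using A v that by (auto dest!: arg_cong[where f="\<lambda>w. w $ i"] simp del: index_mult_mat_vec)
  show "norm \<mu> \<le> norm s + norm t * spectral_radius A"
  \<comment> \<open>Dividing by \<open>t\<close> is impossible when it vanishes; then a nonzero
    coordinate of \<open>v\<close> forces \<open>\<mu> = s\<close>.\<close>
  proof (cases "t = 0")
    case True
    from v obtain i where "i < n" "v $ i \<noteq> 0"
      by (metis carrier_vecD eq_vecI index_zero_vec)
    with comp True have "\<mu> = s" by auto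
    with True show ?thesis by simp
  next
    case False
    have "A *\<^sub>v v = ((\<mu> - s) / t) \<cdot>\<^sub>v v"
    proof (rule eq_vecI)
      fix i assume "i < dim_vec (((\<mu> - s) / t) \<cdot>\<^sub>v v)"
      then have "i < n" using v by simp
      with comp[OF this] False v show "(A *\<^sub>v v) $ i = (((\<mu> - s) / t) \<cdot>\<^sub>v v) $ i"
        by (simp add: field_simps del: index_mult_mat_vec)
    qed (use A v in simp)
    from norm_eigenvalue_le_spectral_radius[OF A n v this]
    have "norm (\<mu> - s) \<le> norm t * spectral_radius A"
      using False by (simp add: norm_divide field_simps)
    with norm_triangle_sub[of \<mu> s] show ?thesis by simp
  qed
qed

lemma spectral_radius_smult_le:
  fixes A :: "complex mat"
  assumes A: "A \<in> carrier_mat n n" and n: "0 < n"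
  shows "spectral_radius (t \<cdot>\<^sub>m A) \<le> norm t * spectral_radius A"
proof -
  have "0 \<cdot>\<^sub>m 1\<^sub>m n + t \<cdot>\<^sub>m A = t \<cdot>\<^sub>m A"
    using A by (intro eq_matI) auto
  with spectral_radius_affine_le[OF A n, of 0 t] show ?thesis by simp
qed

text \<open>Induction on \<open>k\<close> with the triangle inequality for the entries of a product.
  Each entry of \<open>C\<close> and its powers dominates a norm, hence is nonnegative, so the
  termwise bounds may be multiplied.\<close>

lemma norm_pow_mat_le:
  fixes B :: "complex mat" and C :: "real mat"
  assumes B: "B \<in> carrier_mat n n" and C: "C \<in> carrier_mat n n"
    and dom: "\<And>i j. i < n \<Longrightarrow> j < n \<Longrightarrow> norm (B $$ (i, j)) \<le> C $$ (i, j)"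
  shows "i < n \<Longrightarrow> j < n \<Longrightarrow> norm ((B ^\<^sub>m k) $$ (i, j)) \<le> (C ^\<^sub>m k) $$ (i, j)"
proof (induction k arbitrary: i j)
  case 0
  then show ?case using B C by simp
next
  case (Suc k)
  have Bk: "B ^\<^sub>m k \<in> carrier_mat n n" and Ck: "C ^\<^sub>m k \<in> carrier_mat n n"
    using B C by auto
  have "norm ((B ^\<^sub>m Suc k) $$ (i, j)) = norm (\<Sum>l = 0..<n. (B ^\<^sub>m k) $$ (i, l) * B $$ (l, j))"
    using Suc.prems B Bk by (simp add: scalar_prod_def)
  also have "\<dots> \<le> (\<Sum>l = 0..<n. (C ^\<^sub>m k) $$ (i, l) * C $$ (l, j))"
  proof (rule sum_norm_le)
    fix l assume "l \<in> {0..<n}"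
    then show "norm ((B ^\<^sub>m k) $$ (i, l) * B $$ (l, j)) \<le> (C ^\<^sub>m k) $$ (i, l) * C $$ (l, j)"
      using Suc.IH[of i l] dom[of l j] Suc.prems
      by (auto simp: norm_mult intro!: mult_mono intro: order_trans[OF norm_ge_zero])
  qed
  also have "\<dots> = (C ^\<^sub>m Suc k) $$ (i, j)"
    using Suc.prems C Ck by (simp add: scalar_prod_def)
  finally show ?case .
qed

text \<open>An eigenvalue of modulus above 1 makes \<open>A ^\<^sub>m k *\<^sub>v v\<close> grow
  geometrically, whereas entries bounded by \<open>c\<close> keep each of its coordinates below a
  constant independent of \<open>k\<close>.\<close>

lemma spectral_radius_le_1_if_norm_bound:
  assumes A: "A \<in> carrier_mat n n" and n: "0 < n"
    and bound: "\<And>k. norm_bound (A ^\<^sub>m k) c"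
  shows "spectral_radius A \<le> 1"
proof (rule ccontr)
  assume "\<not> spectral_radius A \<le> 1"
  then have "1 < spectral_radius A" by simp
  then obtain v \<mu> where v: "v \<in> carrier_vec n" "v \<noteq> 0\<^sub>v n" and \<mu>: "1 < norm \<mu>"
    and Av: "A *\<^sub>v v = \<mu> \<cdot>\<^sub>v v"
    using spectral_radius_leI[OF A n, of 1] by force
  then have ev: "eigenvector A v \<mu>"
    using A by (simp add: eigenvector_def)
  \<comment> \<open>The growth is observed in a single nonzero coordinate of the
    eigenvector.\<close>
  obtain i where i: "i < n" "v $ i \<noteq> 0"
    using v by (metis carrier_vecD eq_vecI index_zero_vec)
  let ?S = "c * (\<Sum>j = 0..<n. norm (v $ j))"
  have le: "norm \<mu> ^ k * norm (v $ i) \<le> ?S" for k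
  proof -
    have "norm \<mu> ^ k * norm (v $ i) = norm ((A ^\<^sub>m k *\<^sub>v v) $ i)"
      unfolding eigenvector_pow[OF A ev] using i v by (simp add: norm_mult norm_power)
    also have "\<dots> = norm (\<Sum>j = 0..<n. (A ^\<^sub>m k) $$ (i, j) * v $ j)"
      using i v A by (simp add: scalar_prod_def)
    also have "\<dots> \<le> (\<Sum>j = 0..<n. c * norm (v $ j))"
      using bound[of k] i A
      by (intro sum_norm_le) (auto simp: norm_bound_def norm_mult intro!: mult_right_mono)
    finally show ?thesis by (simp add: sum_distrib_left)
  qed
  obtain k where "?S / norm (v $ i) < norm \<mu> ^ k"
    using real_arch_pow[OF \<mu>] by blast
  with le[of k] i show False
    by (simp add: field_simps)
qed

lemma spectral_radius_mono:
  fixes B :: "complex mat" and C :: "real mat"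
  assumes B: "B \<in> carrier_mat n n" and C: "C \<in> carrier_mat n n" and n: "0 < n"
    and dom: "\<And>i j. i < n \<Longrightarrow> j < n \<Longrightarrow> norm (B $$ (i, j)) \<le> C $$ (i, j)"
  shows "spectral_radius B \<le> spec_rad C"
\<comment> \<open>It suffices to bound by every \<open>r\<close> above \<open>spec_rad C\<close>:
  the strict gap puts the spectral radius of \<open>C\<close> scaled by \<open>1 / r\<close> below
  1, the case in which powers stay bounded.\<close>
proof (rule dense_ge)
  fix r assume r: "spec_rad C < r"
  have CC: "complex_mat C \<in> carrier_mat n n" using C by simp
  have r0: "0 < r"
    using r spectral_radius_nonneg[OF CC n] by (simp add: spec_rad_def)
  let ?B = "complex_of_real (1 / r) \<cdot>\<^sub>m B" and ?C = "(1 / r) \<cdot>\<^sub>m C"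
  have B': "?B \<in> carrier_mat n n" and C': "?C \<in> carrier_mat n n"
    and CC': "complex_mat ?C \<in> carrier_mat n n"
    using B C by auto
  have "complex_mat ?C = complex_of_real (1 / r) \<cdot>\<^sub>m complex_mat C"
    by (intro eq_matI) auto
  with spectral_radius_smult_le[OF CC n, of "complex_of_real (1 / r)"]
  have "spectral_radius (complex_mat ?C) \<le> spec_rad C / r"
    using r0 by (simp add: spec_rad_def norm_divide)
  also have "\<dots> < 1" using r r0 by simp
  \<comment> \<open>The Jordan normal form supplies one bound valid for all
    \<open>k\<close>.\<close>
  finally obtain c where c: "norm_bound (complex_mat ?C ^\<^sub>m k) c" for k
    using spectral_radius_jnf_norm_bound_less_1_upper_triangular[OF CC'] by blast
  have "norm_bound (?B ^\<^sub>m k) c" for k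
  proof (rule norm_boundI)
    fix i j assume "i < dim_row (?B ^\<^sub>m k)" "j < dim_col (?B ^\<^sub>m k)"
    then have ij: "i < n" "j < n" using B by (auto split: if_splits)
    have "norm ((?B ^\<^sub>m k) $$ (i, j)) \<le> (?C ^\<^sub>m k) $$ (i, j)"
      by (rule norm_pow_mat_le[OF B' C' _ ij])
         (use dom r0 B C in \<open>auto simp: norm_mult norm_divide divide_right_mono\<close>)
    also have "\<dots> \<le> norm ((complex_mat ?C ^\<^sub>m k) $$ (i, j))"
      unfolding of_real_hom.mat_hom_pow[OF C', symmetric] using ij C by simp
    also have "\<dots> \<le> c"
      using c[of k] ij pow_mat_dim_square[OF CC', of k] by (simp add: norm_bound_def)
    finally show "norm ((?B ^\<^sub>m k) $$ (i, j)) \<le> c" .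
  qed
  then have le1: "spectral_radius ?B \<le> 1"
    by (rule spectral_radius_le_1_if_norm_bound[OF B' n])
  \<comment> \<open>Scaling back by \<open>r\<close> turns the bound 1 for \<open>?B\<close> into
    the bound \<open>r\<close> for \<open>B\<close>.\<close>
  have "complex_of_real r \<cdot>\<^sub>m ?B = B"
    using r0 by (intro eq_matI) auto
  with spectral_radius_smult_le[OF B' n, of "complex_of_real r"]
  have "spectral_radius B \<le> r * spectral_radius ?B"
    using r0 by simp
  also have "\<dots> \<le> r" using le1 r0 by simp
  finally show "spectral_radius B \<le> r" .
qed

theorem theorem3p3:
  fixes n :: nat and T A :: "real mat" and \<rho> :: real
  assumes "0 < n"
    and "T \<in> carrier_mat n n"
    and "A = 1\<^sub>m n - T"
    and "nonneg_mat T"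
    and "spec_rad T < 1"
    and "spec A \<subseteq> complex_of_real ` {0<..}"
    and "\<rho> = spec_rad T"
  shows "(\<forall>\<alpha>. richardson_mat A \<alpha> = (1 - \<alpha>) \<cdot>\<^sub>m 1\<^sub>m n + \<alpha> \<cdot>\<^sub>m T)
    \<and> 1 < 2 / (1 + \<rho>)
    \<and> (\<forall>\<alpha>\<in>{0<..<2 / (1 + \<rho>)}. spec_rad (abs_mat (richardson_mat A \<alpha>)) < 1)"
proof (intro conjI allI ballI)
  note n = assms(1) and T = assms(2)
  have CT: "complex_mat T \<in> carrier_mat n n" using T by simp
  have \<rho>: "0 \<le> \<rho>" "\<rho> < 1"
    using spectral_radius_nonneg[OF CT n] assms(5,7) by (auto simp: spec_rad_def)
  show rich: "richardson_mat A \<alpha> = (1 - \<alpha>) \<cdot>\<^sub>m 1\<^sub>m n + \<alpha> \<cdot>\<^sub>m T" for \<alpha>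
    unfolding richardson_mat_def assms(3)
    using T by (intro eq_matI) (auto simp: algebra_simps)
  show "1 < 2 / (1 + \<rho>)" using \<rho> by simp
  fix \<alpha> assume "\<alpha> \<in> {0<..<2 / (1 + \<rho>)}"
  then have \<alpha>: "0 < \<alpha>" "\<alpha> + \<alpha> * \<rho> < 2"
    using \<rho> by (auto simp: field_simps)
  let ?C = "\<bar>1 - \<alpha>\<bar> \<cdot>\<^sub>m 1\<^sub>m n + \<alpha> \<cdot>\<^sub>m T"
  have Tnn: "0 \<le> T $$ (i, j)" if "i < n" "j < n" for i j
    using assms(4) T that by (simp add: nonneg_mat_def)
  have "spec_rad (abs_mat (richardson_mat A \<alpha>)) \<le> spec_rad ?C"
    \<comment> \<open>The pattern unfolds only the left-hand spectral radius, leaving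
      \<open>spec_rad ?C\<close> in the form that monotonicity concludes.\<close>
    unfolding spec_rad_def[of "map_mat _ _"] rich abs_mat_def
  proof (rule spectral_radius_mono[OF _ _ n])
    fix i j assume ij: "i < n" "j < n"
    \<comment> \<open>Nonnegativity of \<open>T\<close> makes domination an equality off the
      diagonal; on the diagonal the triangle inequality is needed.\<close>
    have "\<bar>\<alpha> * T $$ (i, j)\<bar> = \<alpha> * T $$ (i, j)"
      using \<alpha> Tnn[OF ij] by simp
    then show "norm (complex_mat (map_mat abs ((1 - \<alpha>) \<cdot>\<^sub>m 1\<^sub>m n + \<alpha> \<cdot>\<^sub>m T)) $$ (i, j)) \<le> ?C $$ (i, j)"
      using T ij abs_triangle_ineq[of "1 - \<alpha>" "\<alpha> * T $$ (i, j)"] by auto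
  qed (use T in auto)
  also have "complex_mat ?C
      = complex_of_real \<bar>1 - \<alpha>\<bar> \<cdot>\<^sub>m 1\<^sub>m n + complex_of_real \<alpha> \<cdot>\<^sub>m complex_mat T"
    using T by (intro eq_matI) auto
  then have "spec_rad ?C \<le> \<bar>1 - \<alpha>\<bar> + \<alpha> * \<rho>"
    using spectral_radius_affine_le[OF CT n, of "complex_of_real \<bar>1 - \<alpha>\<bar>" "complex_of_real \<alpha>"]
      \<alpha> assms(7) by (simp add: spec_rad_def)
  \<comment> \<open>For \<alpha> \<le> 1 the sum is \<open>1 - \<alpha> * (1 - \<rho>)\<close>,
    below 1 as \<rho> < 1; for \<alpha> > 1 it is \<open>\<alpha> * (1 + \<rho>) - 1\<close>, below
    1 by the upper limit on \<alpha>.\<close>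
  also have "\<dots> < 1"
    using \<alpha> \<rho> mult_strict_left_mono[OF \<rho>(2) \<alpha>(1)] by (auto simp: abs_if)
  finally show "spec_rad (abs_mat (richardson_mat A \<alpha>)) < 1" .
qed

end
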